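(* Suppose $\rho$ satisfies (C1)--(C4) and (P1). Then, for any adapted process $H\in\mathcal H$ and each fixed $t\in\{0,\ldots,T\}$, $$Y_t^*=\inf_{M\in\mathcal M_0^\rho}\rho_t\Big(\max_{t\le j\le T}(H_j+M_t-M_j)\Big)=\rho_t\Big(\max_{t\le j\le T}(H_j+M_t^*-M_j^* )\Big),$$ where $M^*$ is the $\rho$-Doob martingale of $Y^*$. If in addition $\rho$ is sensitive (P2), then almost surely $$Y_t^*=\max_{t\le j\le T}(H_j+M_t^*-M_j^* ).$$
   Context: $(\Omega,(\mathcal F_t)_{t\in\{0,\ldots,T\}},\mathbb P)$ is a filtered probability space, $\mathcal F=\mathcal F_T$. $\mathfrak X$ is a linear subspace of $L^0(\Omega,\mathcal F,\mathbb P)$, closed under $\wedge$ and $\vee$ and containing all indicators $1_A$, $A\in\mathcal F$. All (in)equalities between random variables are $\mathbb P$-a.s.; $X\in\mathcal F_t$ means $X$ is $\mathcal F_t$-measurable; random variables to which $\rho_t$ is applied are understood to lie in $\mathfrak X$. $\rho=(\rho_t)_{t=0,\ldots,T}$ is a family of maps $\rho_t:\mathfrak X\to\mathfrak X\cap L^0(\Omega,\mathcal F_t,\mathbb P)$. For all $X,Y\in\mathfrak X$ and all $t$: (C1) $X\le Y\Rightarrow\rho_t(X)\le\rho_t(Y)$; (C2) $\rho_t(1_AX)=1_A\rho_t(X)$ for $A\in\mathcal F_t$; (C3) $\rho_t=\rho_t\circ\rho_{t+1}$ for $t\le T-1$; (C4) $\rho_t(X+Y)=\rho_t(X)+Y$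 if $Y\in\mathcal F_t$; (P1) $\rho_t(X+Y)\le\rho_t(X)+\rho_t(Y)$; (P2) if $X\le0$ and $\rho_t(X)\ge0$, then $X=0$. $\mathcal H$ is the set of adapted processes $(U_t)_{t\in\{0,\ldots,T\}}$ with $U_t\in\mathfrak X\cap L^0(\Omega,\mathcal F_t,\mathbb P)$. A $\rho$-martingale is $M\in\mathcal H$ with $M_t=\rho_t(M_{t+1})$ for $0\le t<T$; $\mathcal M_0^\rho$ is the set of $\rho$-martingales with $M_0=0$. $Y_t^*:=\operatorname{ess\,sup}_{\tau\in\mathcal T_t}\rho_t(H_\tau)$ (the upper Snell envelope of $H$), where $\mathcal T_t$ is the set of stopping times with values in $\{t,\ldots,T\}$. The $\rho$-Doob martingale $M^*\in\mathcal M_0^\rho$ is defined by $M^*_0=0$ and $M^*_{t+1}-M^*_t=Y^*_{t+1}-\rho_t(Y^*_{t+1})$, $0\le t<T$. The infimum is an essential infimum. *)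

theory Defs
  imports "HOL-Probability.Probability"
begin

section \<open>Essential suprema and infima of families of random variables\<close>

text \<open>
  The library constant \<open>esssup\<close> is the essential supremum of a single function.  Here we need
  the (almost surely least) measurable function that dominates every member of a possibly
  uncountable family.  It takes extended real values, and \<open>ess_Sup\<close>, \<open>ess_Inf\<close> select
  one version; any two versions agree almost everywhere (lemmas \<open>AE_ess_Sup_eq\<close> and
  \<open>AE_ess_Inf_eq\<close>), and over a probability space a version always exists.
\<close>

definition is_ess_Sup :: "'a measure \<Rightarrow> ('a \<Rightarrow> ereal) set \<Rightarrow> ('a \<Rightarrow> ereal) \<Rightarrow> bool" where
  "is_ess_Sup P \<Phi> Z \<longleftrightarrow>
     Z \<in> borel_measurable P \<and>
     (\<forall>f\<in>\<Phi>. AE \<omega> in P. f \<omega> \<le> Z \<omega>) \<and>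
     (\<forall>W\<in>borel_measurable P. (\<forall>f\<in>\<Phi>. AE \<omega> in P. f \<omega> \<le> W \<omega>) \<longrightarrow> (AE \<omega> in P. Z \<omega> \<le> W \<omega>))"

definition is_ess_Inf :: "'a measure \<Rightarrow> ('a \<Rightarrow> ereal) set \<Rightarrow> ('a \<Rightarrow> ereal) \<Rightarrow> bool" where
  "is_ess_Inf P \<Phi> Z \<longleftrightarrow>
     Z \<in> borel_measurable P \<and>
     (\<forall>f\<in>\<Phi>. AE \<omega> in P. Z \<omega> \<le> f \<omega>) \<and>
     (\<forall>W\<in>borel_measurable P. (\<forall>f\<in>\<Phi>. AE \<omega> in P. W \<omega> \<le> f \<omega>) \<longrightarrow> (AE \<omega> in P. W \<omega> \<le> Z \<omega>))"

definition ess_Sup :: "'a measure \<Rightarrow> ('a \<Rightarrow> ereal) set \<Rightarrow> 'a \<Rightarrow> ereal" where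
  "ess_Sup P \<Phi> = (SOME Z. is_ess_Sup P \<Phi> Z)"

definition ess_Inf :: "'a measure \<Rightarrow> ('a \<Rightarrow> ereal) set \<Rightarrow> 'a \<Rightarrow> ereal" where
  "ess_Inf P \<Phi> = (SOME Z. is_ess_Inf P \<Phi> Z)"

lemma AE_ess_Sup_eq:
  assumes "is_ess_Sup P \<Phi> Z"
  shows "AE \<omega> in P. ess_Sup P \<Phi> \<omega> = Z \<omega>"
proof -
  have "is_ess_Sup P \<Phi> (ess_Sup P \<Phi>)"
    unfolding ess_Sup_def using assms by (rule someI[where P = "is_ess_Sup P \<Phi>"])
  with assms have "AE \<omega> in P. ess_Sup P \<Phi> \<omega> \<le> Z \<omega>" "AE \<omega> in P. Z \<omega> \<le> ess_Sup P \<Phi> \<omega>"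
    unfolding is_ess_Sup_def by blast+
  then show ?thesis by eventually_elim simp
qed

lemma AE_ess_Inf_eq:
  assumes "is_ess_Inf P \<Phi> Z"
  shows "AE \<omega> in P. ess_Inf P \<Phi> \<omega> = Z \<omega>"
proof -
  have "is_ess_Inf P \<Phi> (ess_Inf P \<Phi>)"
    unfolding ess_Inf_def using assms by (rule someI[where P = "is_ess_Inf P \<Phi>"])
  with assms have "AE \<omega> in P. ess_Inf P \<Phi> \<omega> \<le> Z \<omega>" "AE \<omega> in P. Z \<omega> \<le> ess_Inf P \<Phi> \<omega>"
    unfolding is_ess_Inf_def by blast+
  then show ?thesis by eventually_elim simp
qed

section \<open>The probabilistic setting\<close>

text \<open>
  Elements of \<open>L\<^sup>0\<close> are represented by functions, and equality of random variables is almost sure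
  equality.  Accordingly \<open>L0 P G\<close> is the union of those \<open>P\<close>-a.s. equivalence classes that
  contain a \<open>G\<close>-measurable function; \<open>F\<close>-measurability of a random variable always means
  membership in this saturated set.  In particular, \<open>L0 P P = borel_measurable P\<close>.
\<close>

definition L0 :: "'a measure \<Rightarrow> 'a measure \<Rightarrow> ('a \<Rightarrow> real) set" where
  "L0 P G = {X \<in> borel_measurable P. \<exists>X'\<in>borel_measurable G. AE \<omega> in P. X \<omega> = X' \<omega>}"

text \<open>
  The library's filtrations are indexed by the whole type.  Nothing below depends on
  \<open>F t\<close> for \<open>t > T\<close>, and a filtration on \<open>{0..T}\<close> can be continued constantly.
\<close>

locale filtered_prob_space = prob_space P + filtration "space P" F
  for P :: "'a measure" and F :: "nat \<Rightarrow> 'a measure" +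
  fixes T :: nat
  assumes sets_F_T: "sets (F T) = sets P"

text \<open>
  The assumptions \<open>XX_AE_cong\<close> and \<open>rho_AE_cong\<close> say that the domain consists of full
  equivalence classes and that the maps \<open>\<rho> t\<close> are well defined on them.
\<close>

locale conditional_maps = filtered_prob_space P F T
  for P :: "'a measure" and F :: "nat \<Rightarrow> 'a measure" and T :: nat +
  fixes \<XX> :: "('a \<Rightarrow> real) set" and \<rho> :: "nat \<Rightarrow> ('a \<Rightarrow> real) \<Rightarrow> 'a \<Rightarrow> real"
  assumes XX_measurable: "\<XX> \<subseteq> borel_measurable P"
    and XX_AE_cong: "\<And>X Y. X \<in> \<XX> \<Longrightarrow> Y \<in> borel_measurable P \<Longrightarrow> (AE \<omega> in P. X \<omega> = Y \<omega>) \<Longrightarrow> Y \<in> \<XX>"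
    and XX_add: "\<And>X Y. X \<in> \<XX> \<Longrightarrow> Y \<in> \<XX> \<Longrightarrow> (\<lambda>\<omega>. X \<omega> + Y \<omega>) \<in> \<XX>"
    and XX_scale: "\<And>c X. X \<in> \<XX> \<Longrightarrow> (\<lambda>\<omega>. c * X \<omega>) \<in> \<XX>"
    and XX_min: "\<And>X Y. X \<in> \<XX> \<Longrightarrow> Y \<in> \<XX> \<Longrightarrow> (\<lambda>\<omega>. min (X \<omega>) (Y \<omega>)) \<in> \<XX>"
    and XX_max: "\<And>X Y. X \<in> \<XX> \<Longrightarrow> Y \<in> \<XX> \<Longrightarrow> (\<lambda>\<omega>. max (X \<omega>) (Y \<omega>)) \<in> \<XX>"
    and XX_indicator: "\<And>A. A \<in> sets P \<Longrightarrow> indicat_real A \<in> \<XX>"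
    and rho_range: "\<And>t X. t \<le> T \<Longrightarrow> X \<in> \<XX> \<Longrightarrow> \<rho> t X \<in> \<XX> \<inter> L0 P (F t)"
    and rho_AE_cong: "\<And>t X Y. t \<le> T \<Longrightarrow> X \<in> \<XX> \<Longrightarrow> Y \<in> \<XX> \<Longrightarrow> (AE \<omega> in P. X \<omega> = Y \<omega>) \<Longrightarrow>
          (AE \<omega> in P. \<rho> t X \<omega> = \<rho> t Y \<omega>)"

section \<open>Properties of the maps\<close>

definition C1 :: "'a measure \<Rightarrow> nat \<Rightarrow> ('a \<Rightarrow> real) set \<Rightarrow> (nat \<Rightarrow> ('a \<Rightarrow> real) \<Rightarrow> 'a \<Rightarrow> real) \<Rightarrow> bool" where
  "C1 P T \<XX> \<rho> \<longleftrightarrow> (\<forall>t\<le>T. \<forall>X\<in>\<XX>. \<forall>Y\<in>\<XX>.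
     (AE \<omega> in P. X \<omega> \<le> Y \<omega>) \<longrightarrow> (AE \<omega> in P. \<rho> t X \<omega> \<le> \<rho> t Y \<omega>))"

text \<open>
  Closure of \<open>\<XX>\<close> under multiplication by indicators does not follow from the other closure
  properties, so the premise \<open>1\<^sub>A X \<in> \<XX>\<close>, needed for \<open>\<rho> t (1\<^sub>A X)\<close> to make sense, is explicit.
\<close>

definition C2 :: "'a measure \<Rightarrow> (nat \<Rightarrow> 'a measure) \<Rightarrow> nat \<Rightarrow> ('a \<Rightarrow> real) set
    \<Rightarrow> (nat \<Rightarrow> ('a \<Rightarrow> real) \<Rightarrow> 'a \<Rightarrow> real) \<Rightarrow> bool" where
  "C2 P F T \<XX> \<rho> \<longleftrightarrow> (\<forall>t\<le>T. \<forall>X\<in>\<XX>. \<forall>A\<in>sets (F t).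
     (\<lambda>\<omega>. indicat_real A \<omega> * X \<omega>) \<in> \<XX> \<longrightarrow>
     (AE \<omega> in P. \<rho> t (\<lambda>\<omega>. indicat_real A \<omega> * X \<omega>) \<omega> = indicat_real A \<omega> * \<rho> t X \<omega>))"

definition C3 :: "'a measure \<Rightarrow> nat \<Rightarrow> ('a \<Rightarrow> real) set \<Rightarrow> (nat \<Rightarrow> ('a \<Rightarrow> real) \<Rightarrow> 'a \<Rightarrow> real) \<Rightarrow> bool" where
  "C3 P T \<XX> \<rho> \<longleftrightarrow> (\<forall>t<T. \<forall>X\<in>\<XX>. AE \<omega> in P. \<rho> t X \<omega> = \<rho> t (\<rho> (Suc t) X) \<omega>)"

definition C4 :: "'a measure \<Rightarrow> (nat \<Rightarrow> 'a measure) \<Rightarrow> nat \<Rightarrow> ('a \<Rightarrow> real) set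
    \<Rightarrow> (nat \<Rightarrow> ('a \<Rightarrow> real) \<Rightarrow> 'a \<Rightarrow> real) \<Rightarrow> bool" where
  "C4 P F T \<XX> \<rho> \<longleftrightarrow> (\<forall>t\<le>T. \<forall>X\<in>\<XX>. \<forall>Y\<in>\<XX> \<inter> L0 P (F t).
     AE \<omega> in P. \<rho> t (\<lambda>\<omega>. X \<omega> + Y \<omega>) \<omega> = \<rho> t X \<omega> + Y \<omega>)"

definition P1 :: "'a measure \<Rightarrow> nat \<Rightarrow> ('a \<Rightarrow> real) set \<Rightarrow> (nat \<Rightarrow> ('a \<Rightarrow> real) \<Rightarrow> 'a \<Rightarrow> real) \<Rightarrow> bool" where
  "P1 P T \<XX> \<rho> \<longleftrightarrow> (\<forall>t\<le>T. \<forall>X\<in>\<XX>. \<forall>Y\<in>\<XX>.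
     AE \<omega> in P. \<rho> t (\<lambda>\<omega>. X \<omega> + Y \<omega>) \<omega> \<le> \<rho> t X \<omega> + \<rho> t Y \<omega>)"

definition P2 :: "'a measure \<Rightarrow> nat \<Rightarrow> ('a \<Rightarrow> real) set \<Rightarrow> (nat \<Rightarrow> ('a \<Rightarrow> real) \<Rightarrow> 'a \<Rightarrow> real) \<Rightarrow> bool" where
  "P2 P T \<XX> \<rho> \<longleftrightarrow> (\<forall>t\<le>T. \<forall>X\<in>\<XX>.
     (AE \<omega> in P. X \<omega> \<le> 0) \<longrightarrow> (AE \<omega> in P. 0 \<le> \<rho> t X \<omega>) \<longrightarrow> (AE \<omega> in P. X \<omega> = 0))"

section \<open>Processes, martingales and the upper Snell envelope\<close>

text \<open>Processes are indexed by \<open>nat\<close>; only the times \<open>0, \<dots>, T\<close> matter.\<close>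

definition adapted_processes :: "'a measure \<Rightarrow> (nat \<Rightarrow> 'a measure) \<Rightarrow> nat \<Rightarrow> ('a \<Rightarrow> real) set
    \<Rightarrow> (nat \<Rightarrow> 'a \<Rightarrow> real) set" where
  "adapted_processes P F T \<XX> = {U. \<forall>t\<le>T. U t \<in> \<XX> \<inter> L0 P (F t)}"

definition rho_martingales :: "'a measure \<Rightarrow> (nat \<Rightarrow> 'a measure) \<Rightarrow> nat \<Rightarrow> ('a \<Rightarrow> real) set
    \<Rightarrow> (nat \<Rightarrow> ('a \<Rightarrow> real) \<Rightarrow> 'a \<Rightarrow> real) \<Rightarrow> (nat \<Rightarrow> 'a \<Rightarrow> real) set" where
  "rho_martingales P F T \<XX> \<rho> =
     {M \<in> adapted_processes P F T \<XX>. \<forall>t<T. AE \<omega> in P. M t \<omega> = \<rho> t (M (Suc t)) \<omega>}"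

definition rho_martingales_0 :: "'a measure \<Rightarrow> (nat \<Rightarrow> 'a measure) \<Rightarrow> nat \<Rightarrow> ('a \<Rightarrow> real) set
    \<Rightarrow> (nat \<Rightarrow> ('a \<Rightarrow> real) \<Rightarrow> 'a \<Rightarrow> real) \<Rightarrow> (nat \<Rightarrow> 'a \<Rightarrow> real) set" where
  "rho_martingales_0 P F T \<XX> \<rho> = {M \<in> rho_martingales P F T \<XX> \<rho>. AE \<omega> in P. M 0 \<omega> = 0}"

definition stopping_times :: "'a measure \<Rightarrow> (nat \<Rightarrow> 'a measure) \<Rightarrow> nat \<Rightarrow> nat \<Rightarrow> ('a \<Rightarrow> nat) set" where
  "stopping_times P F T t = {\<tau>. stopping_time F \<tau> \<and> (\<forall>\<omega>\<in>space P. \<tau> \<omega> \<in> {t..T})}"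

definition stopped_value :: "(nat \<Rightarrow> 'a \<Rightarrow> real) \<Rightarrow> ('a \<Rightarrow> nat) \<Rightarrow> 'a \<Rightarrow> real" where
  "stopped_value H \<tau> = (\<lambda>\<omega>. H (\<tau> \<omega>) \<omega>)"

definition upper_Snell :: "'a measure \<Rightarrow> (nat \<Rightarrow> 'a measure) \<Rightarrow> nat
    \<Rightarrow> (nat \<Rightarrow> ('a \<Rightarrow> real) \<Rightarrow> 'a \<Rightarrow> real) \<Rightarrow> (nat \<Rightarrow> 'a \<Rightarrow> real) \<Rightarrow> nat \<Rightarrow> 'a \<Rightarrow> ereal" where
  "upper_Snell P F T \<rho> H t =
     ess_Sup P ((\<lambda>\<tau> \<omega>. ereal (\<rho> t (stopped_value H \<tau>) \<omega>)) ` stopping_times P F T t)"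

text \<open>
  The Doob martingale is formed from an extended real valued process because the upper Snell envelope
  is an essential supremum; the conversion to \<open>real\<close> is harmless wherever the process is finite.
\<close>

primrec Doob_martingale :: "(nat \<Rightarrow> ('a \<Rightarrow> real) \<Rightarrow> 'a \<Rightarrow> real) \<Rightarrow> (nat \<Rightarrow> 'a \<Rightarrow> ereal)
    \<Rightarrow> nat \<Rightarrow> 'a \<Rightarrow> real" where
  "Doob_martingale \<rho> Y 0 = (\<lambda>\<omega>. 0)"
| "Doob_martingale \<rho> Y (Suc t) = (\<lambda>\<omega>. Doob_martingale \<rho> Y t \<omega> +
     (real_of_ereal (Y (Suc t) \<omega>) - \<rho> t (\<lambda>\<omega>'. real_of_ereal (Y (Suc t) \<omega>')) \<omega>))"

text \<open>
  For the upper Snell envelope to make sense the stopped values \<open>H\<^sub>\<tau>\<close> have to belong to \<open>\<XX>\<close>.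
  This is automatic if \<open>\<XX>\<close> is closed under multiplication by indicators.
\<close>

lemma (in conditional_maps) stopped_value_in_XX:
  assumes closed: "\<And>A X. A \<in> sets P \<Longrightarrow> X \<in> \<XX> \<Longrightarrow> (\<lambda>\<omega>. indicat_real A \<omega> * X \<omega>) \<in> \<XX>"
    and H: "H \<in> adapted_processes P F T \<XX>"
    and \<tau>: "\<tau> \<in> stopping_times P F T t"
  shows "stopped_value H \<tau> \<in> \<XX>"
proof -
  have st: "stopping_time F \<tau>" and range: "\<And>\<omega>. \<omega> \<in> space P \<Longrightarrow> \<tau> \<omega> \<le> T"
    using \<tau> by (auto simp: stopping_times_def)
  have le: "{\<omega> \<in> space P. \<tau> \<omega> \<le> j} \<in> sets P" if "j \<le> T" for j
    using stopping_timeD[OF st, of j] sets_F_mono[OF that] sets_F_T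
    by (auto simp: pred_def space_F)
  define A where "A j = {\<omega> \<in> space P. \<tau> \<omega> = j}" for j
  have A: "A j \<in> sets P" if "j \<le> T" for j
  proof (cases j)
    case 0
    then show ?thesis using le[of 0] by (simp add: A_def)
  next
    case (Suc i)
    have "A j = {\<omega> \<in> space P. \<tau> \<omega> \<le> j} - {\<omega> \<in> space P. \<tau> \<omega> \<le> i}"
      by (auto simp: A_def Suc)
    then show ?thesis using le[of j] le[of i] that Suc by auto
  qed
  define B where "B j = (\<lambda>\<omega>. indicat_real (A j) \<omega> * H j \<omega>)" for j
  have B: "B j \<in> \<XX>" if "j \<le> T" for j
    unfolding B_def using closed[OF A[OF that]] H that by (simp add: adapted_processes_def)
  have sum_in: "(\<lambda>\<omega>. \<Sum>j\<le>n. B j \<omega>) \<in> \<XX>" if "n \<le> T" for n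
    using that
  proof (induction n)
    case 0
    then show ?case using B[of 0] by simp
  next
    case (Suc n)
    then show ?case using XX_add[OF _ B[of "Suc n"]] by simp
  qed
  have eq: "(\<Sum>j\<le>T. B j \<omega>) = stopped_value H \<tau> \<omega>" if "\<omega> \<in> space P" for \<omega>
  proof -
    have "(\<Sum>j\<le>T. B j \<omega>) = (\<Sum>j\<le>T. if j = \<tau> \<omega> then H j \<omega> else 0)"
      using that by (intro sum.cong) (auto simp: A_def B_def indicator_def)
    also have "\<dots> = stopped_value H \<tau> \<omega>"
      using range[OF that] by (simp add: stopped_value_def)
    finally show ?thesis .
  qed
  have "(\<lambda>\<omega>. \<Sum>j\<le>T. B j \<omega>) \<in> borel_measurable P"
    using sum_in[of T] XX_measurable by auto
  then have "stopped_value H \<tau> \<in> borel_measurable P"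
    using eq by (simp cong: measurable_cong_simp)
  moreover have "AE \<omega> in P. (\<Sum>j\<le>T. B j \<omega>) = stopped_value H \<tau> \<omega>"
    by (rule AE_I2) (rule eq)
  ultimately show ?thesis
    using XX_AE_cong[OF sum_in[of T]] by simp
qed

end

theory Submission
  imports Defs
begin

text \<open>
  The upper Snell envelope obeys the dynamic programming recursion
  \<open>V\<^sub>T = H\<^sub>T\<close>, \<open>V\<^sub>t = max H\<^sub>t (\<rho>\<^sub>t V\<^sub>t\<^sub>+\<^sub>1)\<close>.  Here the recursion defines
  \<open>V\<close> (\<open>dp_value\<close>), and it is shown that \<open>V\<^sub>t\<close> dominates \<open>\<rho>\<^sub>t H\<^sub>\<tau>\<close> for every stopping time \<open>\<tau> \<ge> t\<close>
  (\<open>rho_stopped_le_value\<close>) and equals it for one of them (\<open>value_attained\<close>), so that \<open>V = Y\<^sup>*\<close>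
  almost surely.  Both parts compare \<open>H\<^sub>\<tau>\<close> on the event \<open>{\<tau> = t}\<close> with \<open>H\<^sub>t\<close> and on its
  complement with the value stopped after \<open>t\<close>.  They therefore rest on locality of \<open>\<rho>\<^sub>t\<close>
  (\<open>rho_local\<close>): random variables that agree on an event \<open>A\<close> of \<open>F\<^sub>t\<close> have images
  that agree on \<open>A\<close>.

  Let \<open>Z\<^sub>t(M) = max\<^sub>j\<^sub>\<ge>\<^sub>t (H\<^sub>j + M\<^sub>t - M\<^sub>j)\<close> (\<open>path_max\<close>).  For every \<open>\<rho>\<close>-martingale \<open>M\<close> one has
  \<open>V\<^sub>t \<le> \<rho>\<^sub>t Z\<^sub>t(M)\<close> (\<open>value_le_rho_path_max\<close>), by backward induction: \<open>Z\<^sub>t(M)\<close> dominates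
  \<open>H\<^sub>t\<close>, and \<open>Z\<^sub>t\<^sub>+\<^sub>1(M) \<le> Z\<^sub>t(M) + (M\<^sub>t\<^sub>+\<^sub>1 - M\<^sub>t)\<close>, where subadditivity removes the
  martingale increment after an application of \<open>\<rho>\<^sub>t\<close>.  The textbook argument through
  optional sampling would apply \<open>\<rho>\<^sub>t\<close> to \<open>M\<^sub>\<tau>\<close>, which need not lie in the domain of \<open>\<rho>\<^sub>t\<close>.

  Conversely, the increments of \<open>M\<^sup>*\<close> are chosen such that \<open>V - M\<^sup>*\<close> decreases by
  \<open>V\<^sub>t - \<rho>\<^sub>t V\<^sub>t\<^sub>+\<^sub>1 \<ge> 0\<close>.  With \<open>H \<le> V\<close> this gives \<open>Z\<^sub>t(M\<^sup>*) \<le> V\<^sub>t\<close> pathwise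
  (\<open>path_max_Doob_le_value\<close>), hence \<open>\<rho>\<^sub>t Z\<^sub>t(M\<^sup>*) = V\<^sub>t\<close>, and the infimum is attained at
  \<open>M\<^sup>*\<close>.  Finally \<open>Z\<^sub>t(M\<^sup>*) - V\<^sub>t\<close> is nonpositive with image \<open>0\<close>, so sensitivity forces
  it to vanish.
\<close>

section \<open>Random variables measurable up to null sets\<close>

lemma L0_measurable: "X \<in> L0 P G \<Longrightarrow> X \<in> borel_measurable P"
  by (simp add: L0_def)

lemma L0_version:
  assumes "X \<in> L0 P G"
  obtains X' where "X' \<in> borel_measurable G" "AE \<omega> in P. X \<omega> = X' \<omega>"
  using assms by (auto simp: L0_def)

lemma L0_compose2:
  fixes P G :: "'a measure" and g :: "real \<Rightarrow> real \<Rightarrow> real"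
  assumes g: "\<And>(M :: 'a measure) f h. f \<in> borel_measurable M \<Longrightarrow> h \<in> borel_measurable M \<Longrightarrow>
      (\<lambda>\<omega>. g (f \<omega>) (h \<omega>)) \<in> borel_measurable M"
    and X: "X \<in> L0 P G" and Y: "Y \<in> L0 P G"
  shows "(\<lambda>\<omega>. g (X \<omega>) (Y \<omega>)) \<in> L0 P G"
proof -
  obtain X' where X': "X' \<in> borel_measurable G" "AE \<omega> in P. X \<omega> = X' \<omega>"
    using L0_version[OF X] .
  obtain Y' where Y': "Y' \<in> borel_measurable G" "AE \<omega> in P. Y \<omega> = Y' \<omega>"
    using L0_version[OF Y] .
  have "AE \<omega> in P. g (X \<omega>) (Y \<omega>) = g (X' \<omega>) (Y' \<omega>)"
    using X'(2) Y'(2) by eventually_elim simp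
  then show ?thesis
    unfolding L0_def
    using g[OF L0_measurable[OF X] L0_measurable[OF Y]] g[OF X'(1) Y'(1)]
    by (intro CollectI conjI bexI[where x = "\<lambda>\<omega>. g (X' \<omega>) (Y' \<omega>)"])
qed

lemma L0_add: "X \<in> L0 P G \<Longrightarrow> Y \<in> L0 P G \<Longrightarrow> (\<lambda>\<omega>. X \<omega> + Y \<omega>) \<in> L0 P G"
  by (rule L0_compose2[OF borel_measurable_add])

lemma L0_diff: "X \<in> L0 P G \<Longrightarrow> Y \<in> L0 P G \<Longrightarrow> (\<lambda>\<omega>. X \<omega> - Y \<omega>) \<in> L0 P G"
  by (rule L0_compose2[OF borel_measurable_diff])

lemma L0_max: "X \<in> L0 P G \<Longrightarrow> Y \<in> L0 P G \<Longrightarrow> (\<lambda>\<omega>. max (X \<omega>) (Y \<omega>)) \<in> L0 P G"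
  by (rule L0_compose2[OF borel_measurable_max])

lemma L0_const: "(\<lambda>\<omega>. c) \<in> L0 P G"
  by (auto simp: L0_def)

lemma L0_AE_cong:
  assumes X: "X \<in> L0 P G" and Y: "Y \<in> borel_measurable P" and eq: "AE \<omega> in P. X \<omega> = Y \<omega>"
  shows "Y \<in> L0 P G"
proof -
  obtain X' where X': "X' \<in> borel_measurable G" "AE \<omega> in P. X \<omega> = X' \<omega>"
    using L0_version[OF X] .
  have "AE \<omega> in P. Y \<omega> = X' \<omega>"
    using eq X'(2) by eventually_elim simp
  with X'(1) Y show ?thesis by (auto simp: L0_def)
qed

lemma is_ess_Sup_attained:
  assumes "Z \<in> borel_measurable P"
    and "\<And>f. f \<in> \<Phi> \<Longrightarrow> AE \<omega> in P. f \<omega> \<le> Z \<omega>"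
    and g: "g \<in> \<Phi>" "AE \<omega> in P. g \<omega> = Z \<omega>"
  shows "is_ess_Sup P \<Phi> Z"
  unfolding is_ess_Sup_def
proof (intro conjI ballI impI)
  fix W assume "\<forall>f\<in>\<Phi>. AE \<omega> in P. f \<omega> \<le> W \<omega>"
  then have "AE \<omega> in P. g \<omega> \<le> W \<omega>" using g(1) by blast
  with g(2) show "AE \<omega> in P. Z \<omega> \<le> W \<omega>" by eventually_elim simp
qed (use assms in auto)

lemma is_ess_Inf_attained:
  assumes "Z \<in> borel_measurable P"
    and "\<And>f. f \<in> \<Phi> \<Longrightarrow> AE \<omega> in P. Z \<omega> \<le> f \<omega>"
    and g: "g \<in> \<Phi>" "AE \<omega> in P. g \<omega> = Z \<omega>"
  shows "is_ess_Inf P \<Phi> Z"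
  unfolding is_ess_Inf_def
proof (intro conjI ballI impI)
  fix W assume "\<forall>f\<in>\<Phi>. AE \<omega> in P. W \<omega> \<le> f \<omega>"
  then have "AE \<omega> in P. W \<omega> \<le> g \<omega>" using g(1) by blast
  with g(2) show "AE \<omega> in P. W \<omega> \<le> Z \<omega>" by eventually_elim simp
qed (use assms in auto)

section \<open>Subadditive conditional maps and their locality\<close>

lemma (in conditional_maps) L0_F_mono:
  assumes "s \<le> t" "X \<in> L0 P (F s)"
  shows "X \<in> L0 P (F t)"
proof -
  have "borel_measurable (F s) \<subseteq> borel_measurable (F t)"
    using sets_F_mono[OF assms(1)] by (intro measurable_mono) (auto simp: space_F)
  then show ?thesis using assms(2) by (auto simp: L0_def)
qed

lemma (in conditional_maps) XX_zero: "(\<lambda>\<omega>. 0) \<in> \<XX>"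
  using XX_scale[OF XX_indicator[of "{}"], of 0] by simp

lemma (in conditional_maps) XX_diff:
  assumes "X \<in> \<XX>" "Y \<in> \<XX>"
  shows "(\<lambda>\<omega>. X \<omega> - Y \<omega>) \<in> \<XX>"
  using XX_add[OF assms(1) XX_scale[OF assms(2), of "-1"]] by simp

lemma (in conditional_maps) XX_Max:
  assumes "finite J" "J \<noteq> {}" "\<And>j. j \<in> J \<Longrightarrow> f j \<in> \<XX>"
  shows "(\<lambda>\<omega>. MAX j\<in>J. f j \<omega>) \<in> \<XX>"
  using assms
proof (induction J rule: finite_ne_induct)
  case (insert j J)
  then show ?case using XX_max[of "f j" "\<lambda>\<omega>. MAX j\<in>J. f j \<omega>"] by simp
qed simp

locale subadditive_conditional_maps = conditional_maps P F T \<XX> \<rho>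
  for P :: "'a measure" and F T \<XX> \<rho> +
  assumes C1: "C1 P T \<XX> \<rho>" and C2: "C2 P F T \<XX> \<rho>" and C3: "C3 P T \<XX> \<rho>"
    and C4: "C4 P F T \<XX> \<rho>" and P1: "P1 P T \<XX> \<rho>"
begin

lemma rho_XX: "t \<le> T \<Longrightarrow> X \<in> \<XX> \<Longrightarrow> \<rho> t X \<in> \<XX>"
  and rho_L0: "t \<le> T \<Longrightarrow> X \<in> \<XX> \<Longrightarrow> \<rho> t X \<in> L0 P (F t)"
  using rho_range by auto

lemma rho_mono:
  assumes "t \<le> T" "X \<in> \<XX>" "Y \<in> \<XX>" "AE \<omega> in P. X \<omega> \<le> Y \<omega>"
  shows "AE \<omega> in P. \<rho> t X \<omega> \<le> \<rho> t Y \<omega>"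
  using C1 assms by (simp add: C1_def)

lemma rho_indicator:
  assumes "t \<le> T" "X \<in> \<XX>" "A \<in> sets (F t)" "(\<lambda>\<omega>. indicat_real A \<omega> * X \<omega>) \<in> \<XX>"
  shows "AE \<omega> in P. \<rho> t (\<lambda>\<omega>. indicat_real A \<omega> * X \<omega>) \<omega> = indicat_real A \<omega> * \<rho> t X \<omega>"
  using C2 assms by (simp add: C2_def)

lemma rho_tower:
  assumes "t < T" "X \<in> \<XX>"
  shows "AE \<omega> in P. \<rho> t X \<omega> = \<rho> t (\<rho> (Suc t) X) \<omega>"
  using C3 assms by (simp add: C3_def)

lemma rho_add:
  assumes "t \<le> T" "X \<in> \<XX>" "Y \<in> \<XX>" "Y \<in> L0 P (F t)"
  shows "AE \<omega> in P. \<rho> t (\<lambda>\<omega>. X \<omega> + Y \<omega>) \<omega> = \<rho> t X \<omega> + Y \<omega>"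
  using C4 assms by (simp add: C4_def)

lemma rho_diff:
  assumes "t \<le> T" "X \<in> \<XX>" "Y \<in> \<XX>" "Y \<in> L0 P (F t)"
  shows "AE \<omega> in P. \<rho> t (\<lambda>\<omega>. X \<omega> - Y \<omega>) \<omega> = \<rho> t X \<omega> - Y \<omega>"
  using rho_add[OF assms(1,2) XX_diff[OF XX_zero assms(3)] L0_diff[OF L0_const assms(4)]] by simp

lemma rho_subadd:
  assumes "t \<le> T" "X \<in> \<XX>" "Y \<in> \<XX>"
  shows "AE \<omega> in P. \<rho> t (\<lambda>\<omega>. X \<omega> + Y \<omega>) \<omega> \<le> \<rho> t X \<omega> + \<rho> t Y \<omega>"
  using P1 assms by (simp add: P1_def)

lemma rho_zero: "t \<le> T \<Longrightarrow> AE \<omega> in P. \<rho> t (\<lambda>\<omega>. 0) \<omega> = 0"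
  using rho_indicator[of t "\<lambda>\<omega>. 0" "{}"] XX_zero by simp

lemma rho_id:
  assumes "t \<le> T" "X \<in> \<XX>" "X \<in> L0 P (F t)"
  shows "AE \<omega> in P. \<rho> t X \<omega> = X \<omega>"
  using rho_add[OF assms(1) XX_zero assms(2,3)] rho_zero[OF assms(1)]
  by eventually_elim simp

text \<open>
  Localising \<open>X\<close> and \<open>Y\<close> separately would need \<open>1\<^sub>A X\<close> and \<open>1\<^sub>A Y\<close> in the domain, which is not
  guaranteed.  But \<open>X - Y\<close> is in the domain and already equals its own localisation to the
  complement of \<open>A\<close>, so \<open>\<rho>\<^sub>t (X - Y)\<close> vanishes on \<open>A\<close>, and subadditivity transfers this to
  \<open>\<rho>\<^sub>t X \<le> \<rho>\<^sub>t Y\<close> on \<open>A\<close>.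
\<close>

lemma rho_local_le:
  assumes t: "t \<le> T" and X: "X \<in> \<XX>" and Y: "Y \<in> \<XX>" and A: "A \<in> sets (F t)"
    and eq: "AE \<omega> in P. \<omega> \<in> A \<longrightarrow> X \<omega> = Y \<omega>"
  shows "AE \<omega> in P. \<omega> \<in> A \<longrightarrow> \<rho> t X \<omega> \<le> \<rho> t Y \<omega>"
proof -
  define D where "D = (\<lambda>\<omega>. X \<omega> - Y \<omega>)"
  define B where "B = space P - A"
  have D: "D \<in> \<XX>" unfolding D_def by (rule XX_diff[OF X Y])
  have B: "B \<in> sets (F t)" unfolding B_def using A by (metis sets.compl_sets space_F)
  then have BP: "B \<in> sets P" using sets_F_mono[OF t] sets_F_T by auto
  have DB: "AE \<omega> in P. D \<omega> = indicat_real B \<omega> * D \<omega>"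
    using eq AE_space by eventually_elim (auto simp: D_def B_def indicator_def)
  have BD: "(\<lambda>\<omega>. indicat_real B \<omega> * D \<omega>) \<in> \<XX>"
    using D XX_measurable BP by (intro XX_AE_cong[OF D _ DB]) (auto intro!: borel_measurable_times)
  have "AE \<omega> in P. \<rho> t (\<lambda>\<omega>. Y \<omega> + D \<omega>) \<omega> \<le> \<rho> t Y \<omega> + \<rho> t D \<omega>"
    by (rule rho_subadd[OF t Y D])
  with rho_AE_cong[OF t D BD DB] rho_indicator[OF t D B BD]
  show ?thesis by eventually_elim (auto simp: D_def B_def)
qed

lemma rho_local:
  assumes t: "t \<le> T" and X: "X \<in> \<XX>" and Y: "Y \<in> \<XX>" and A: "A \<in> sets (F t)"
    and eq: "AE \<omega> in P. \<omega> \<in> A \<longrightarrow> X \<omega> = Y \<omega>"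
  shows "AE \<omega> in P. \<omega> \<in> A \<longrightarrow> \<rho> t X \<omega> = \<rho> t Y \<omega>"
proof -
  have "AE \<omega> in P. \<omega> \<in> A \<longrightarrow> Y \<omega> = X \<omega>" using eq by eventually_elim simp
  from rho_local_le[OF t X Y A eq] rho_local_le[OF t Y X A this]
  show ?thesis by eventually_elim auto
qed

end

section \<open>Dynamic programming for the upper Snell envelope\<close>

text \<open>The value \<open>H\<^sub>T\<close> at times \<open>t > T\<close> is a default.\<close>

function dp_value :: "(nat \<Rightarrow> ('a \<Rightarrow> real) \<Rightarrow> 'a \<Rightarrow> real) \<Rightarrow> (nat \<Rightarrow> 'a \<Rightarrow> real) \<Rightarrow> nat
    \<Rightarrow> nat \<Rightarrow> 'a \<Rightarrow> real" where
  "dp_value \<rho> H T t =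
     (if t < T then (\<lambda>\<omega>. max (H t \<omega>) (\<rho> t (dp_value \<rho> H T (Suc t)) \<omega>)) else H T)"
  by auto
termination by (relation "Wellfounded.measure (\<lambda>(\<rho>, H, T, t). T - t)") auto

declare dp_value.simps [simp del]

locale optimal_stopping = subadditive_conditional_maps P F T \<XX> \<rho>
  for P :: "'a measure" and F T \<XX> \<rho> +
  fixes H :: "nat \<Rightarrow> 'a \<Rightarrow> real"
  assumes H: "H \<in> adapted_processes P F T \<XX>"
    and H_stopped: "\<And>\<tau>. \<tau> \<in> stopping_times P F T 0 \<Longrightarrow> stopped_value H \<tau> \<in> \<XX>"
begin

abbreviation V where "V \<equiv> dp_value \<rho> H T"

lemma H_XX: "t \<le> T \<Longrightarrow> H t \<in> \<XX>" and H_L0: "t \<le> T \<Longrightarrow> H t \<in> L0 P (F t)"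
  using H by (auto simp: adapted_processes_def)

lemma V_T: "V T = H T"
  by (simp add: dp_value.simps[of \<rho> H T T])

lemma V_rec: "t < T \<Longrightarrow> V t = (\<lambda>\<omega>. max (H t \<omega>) (\<rho> t (V (Suc t)) \<omega>))"
  by (simp add: dp_value.simps[of \<rho> H T t])

lemma V_in: "t \<le> T \<Longrightarrow> V t \<in> \<XX> \<inter> L0 P (F t)"
proof (induction t rule: inc_induct)
  case base
  then show ?case by (simp add: V_T H_XX H_L0)
next
  case (step t)
  then show ?case
    using XX_max[OF H_XX[of t] rho_XX[of t "V (Suc t)"]] L0_max[OF H_L0[of t] rho_L0[of t "V (Suc t)"]]
    by (simp add: V_rec)
qed

lemma V_XX: "t \<le> T \<Longrightarrow> V t \<in> \<XX>" and V_L0: "t \<le> T \<Longrightarrow> V t \<in> L0 P (F t)"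
  using V_in by auto

lemma H_le_V: "t \<le> T \<Longrightarrow> H t \<omega> \<le> V t \<omega>"
  by (cases "t = T") (simp_all add: V_T V_rec)

lemma stopped_XX:
  assumes "\<tau> \<in> stopping_times P F T t"
  shows "stopped_value H \<tau> \<in> \<XX>"
  using assms by (intro H_stopped) (auto simp: stopping_times_def)

text \<open>
  Backward induction: on \<open>{\<tau> = t}\<close> the stopped value is \<open>H\<^sub>t\<close>, and elsewhere it is the value
  stopped at \<open>max \<tau> (t + 1)\<close>, which the tower property and the induction hypothesis bound
  by \<open>\<rho>\<^sub>t V\<^sub>t\<^sub>+\<^sub>1\<close>.
\<close>

lemma rho_stopped_le_value:
  assumes "t \<le> T"
  shows "\<tau> \<in> stopping_times P F T t \<Longrightarrow> AE \<omega> in P. \<rho> t (stopped_value H \<tau>) \<omega> \<le> V t \<omega>"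
  using assms
proof (induction t arbitrary: \<tau> rule: inc_induct)
  case base
  have "AE \<omega> in P. stopped_value H \<tau> \<omega> = H T \<omega>"
    using base by (intro AE_I2) (auto simp: stopping_times_def stopped_value_def)
  from rho_AE_cong[OF order_refl stopped_XX[OF base] H_XX this] rho_id[OF order_refl H_XX H_L0]
  show ?case by (auto simp: V_T)
next
  case (step t)
  define A where "A = {\<omega> \<in> space P. \<tau> \<omega> \<le> t}"
  define \<sigma> where "\<sigma> = (\<lambda>\<omega>. max (\<tau> \<omega>) (Suc t))"
  have st: "stopping_time F \<tau>" and range: "\<And>\<omega>. \<omega> \<in> space P \<Longrightarrow> \<tau> \<omega> \<in> {t..T}"
    using step.prems by (auto simp: stopping_times_def)
  have A: "A \<in> sets (F t)"
    using stopping_timeD[OF st, of t] by (simp add: A_def pred_def space_F)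
  have Ac: "space P - A \<in> sets (F t)" using A by (metis sets.compl_sets space_F)
  have \<sigma>: "\<sigma> \<in> stopping_times P F T (Suc t)"
    using st range step.hyps unfolding stopping_times_def \<sigma>_def
    by (auto intro!: stopping_time_max stopping_time_const)
  have t: "t \<le> T" using step.hyps by simp
  have onA: "AE \<omega> in P. \<omega> \<in> A \<longrightarrow> \<rho> t (stopped_value H \<tau>) \<omega> = \<rho> t (H t) \<omega>"
    using range by (intro rho_local[OF t stopped_XX[OF step.prems] H_XX[OF t] A] AE_I2)
      (fastforce simp: A_def stopped_value_def)
  have offA: "AE \<omega> in P. \<omega> \<in> space P - A \<longrightarrow>
      \<rho> t (stopped_value H \<tau>) \<omega> = \<rho> t (stopped_value H \<sigma>) \<omega>"
    by (intro rho_local[OF t stopped_XX[OF step.prems] stopped_XX[OF \<sigma>] Ac] AE_I2)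
      (auto simp: A_def \<sigma>_def stopped_value_def max_absorb1)
  have "AE \<omega> in P. \<rho> t (\<rho> (Suc t) (stopped_value H \<sigma>)) \<omega> \<le> \<rho> t (V (Suc t)) \<omega>"
    using step.hyps by (intro rho_mono t rho_XX stopped_XX[OF \<sigma>] V_XX step.IH \<sigma>) auto
  with onA offA rho_id[OF t H_XX[OF t] H_L0[OF t]] rho_tower[OF step.hyps(2) stopped_XX[OF \<sigma>]]
    AE_space
  show ?case
    by eventually_elim (auto simp: V_rec[OF step.hyps(2)] le_max_iff_disj)
qed

text \<open>
  The optimal rule stops as soon as \<open>H\<^sub>t \<ge> \<rho>\<^sub>t V\<^sub>t\<^sub>+\<^sub>1\<close>.  Both sides are measurable for \<open>F\<^sub>t\<close> only up to
  null sets, so the stopping event is built from \<open>F\<^sub>t\<close>-measurable versions of them.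
\<close>

lemma value_attained:
  assumes "t \<le> T"
  shows "\<exists>\<tau>\<in>stopping_times P F T t. AE \<omega> in P. \<rho> t (stopped_value H \<tau>) \<omega> = V t \<omega>"
  using assms
proof (induction t rule: inc_induct)
  case base
  have "(\<lambda>\<omega>. T) \<in> stopping_times P F T T"
    by (simp add: stopping_times_def stopping_time_const)
  moreover have "stopped_value H (\<lambda>\<omega>. T) = H T" by (simp add: stopped_value_def)
  ultimately show ?case
    using rho_id[OF order_refl H_XX[OF order_refl] H_L0[OF order_refl]]
    by (intro bexI[where x = "\<lambda>\<omega>. T"]) (simp_all add: V_T)
next
  case (step t)
  then obtain \<sigma> where \<sigma>: "\<sigma> \<in> stopping_times P F T (Suc t)"
    and opt: "AE \<omega> in P. \<rho> (Suc t) (stopped_value H \<sigma>) \<omega> = V (Suc t) \<omega>"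
    by blast
  have t: "t \<le> T" and t': "Suc t \<le> T" using step.hyps by auto
  obtain H' where H': "H' \<in> borel_measurable (F t)" "AE \<omega> in P. H t \<omega> = H' \<omega>"
    using L0_version[OF H_L0[OF t]] .
  obtain R where R: "R \<in> borel_measurable (F t)" "AE \<omega> in P. \<rho> t (V (Suc t)) \<omega> = R \<omega>"
    using L0_version[OF rho_L0[OF t V_XX[OF t']]] .
  define A where "A = {\<omega> \<in> space P. R \<omega> \<le> H' \<omega>}"
  define \<tau> where "\<tau> = (\<lambda>\<omega>. if \<omega> \<in> A then t else \<sigma> \<omega>)"
  have A: "A \<in> sets (F t)"
    using borel_measurable_le[OF R(1) H'(1)] by (simp add: A_def space_F)
  have Ac: "space P - A \<in> sets (F t)" using A by (metis sets.compl_sets space_F)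
  have range: "\<tau> \<omega> \<in> {t..T}" if "\<omega> \<in> space P" for \<omega>
    using \<sigma> t that by (force simp: \<tau>_def stopping_times_def)
  have \<tau>: "\<tau> \<in> stopping_times P F T t"
    unfolding stopping_times_def
  proof (intro CollectI conjI ballI range)
    have \<sigma>_le: "{\<omega> \<in> space P. \<sigma> \<omega> \<le> s} \<in> sets (F s)" for s
      using \<sigma> stopping_timeD[of F \<sigma> s] by (simp add: stopping_times_def pred_def space_F)
    have "{\<omega> \<in> space P. \<tau> \<omega> \<le> s} \<in> sets (F s)" for s
    proof (cases "t \<le> s")
      case True
      then have "{\<omega> \<in> space P. \<tau> \<omega> \<le> s} = A \<union> {\<omega> \<in> space P. \<sigma> \<omega> \<le> s}"
        by (auto simp: \<tau>_def A_def)
      moreover have "A \<in> sets (F s)" using A sets_F_mono[OF True] by auto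
      ultimately show ?thesis using \<sigma>_le[of s] by simp
    next
      case False
      moreover have "t \<le> \<tau> \<omega>" if "\<omega> \<in> space P" for \<omega>
        using range[OF that] by simp
      ultimately have "{\<omega> \<in> space P. \<tau> \<omega> \<le> s} = {}"
        by (auto dest: order_trans)
      then show ?thesis by (simp only: sets.empty_sets)
    qed
    then show "stopping_time F \<tau>" by (simp add: stopping_time_def pred_def space_F)
  qed
  have onA: "AE \<omega> in P. \<omega> \<in> A \<longrightarrow> \<rho> t (stopped_value H \<tau>) \<omega> = \<rho> t (H t) \<omega>"
    by (intro rho_local[OF t stopped_XX[OF \<tau>] H_XX[OF t] A] AE_I2)
      (simp add: \<tau>_def stopped_value_def)
  have offA: "AE \<omega> in P. \<omega> \<in> space P - A \<longrightarrow>
      \<rho> t (stopped_value H \<tau>) \<omega> = \<rho> t (stopped_value H \<sigma>) \<omega>"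
    by (intro rho_local[OF t stopped_XX[OF \<tau>] stopped_XX[OF \<sigma>] Ac] AE_I2)
      (simp add: \<tau>_def stopped_value_def)
  have "AE \<omega> in P. \<rho> t (\<rho> (Suc t) (stopped_value H \<sigma>)) \<omega> = \<rho> t (V (Suc t)) \<omega>"
    by (rule rho_AE_cong[OF t rho_XX[OF t' stopped_XX[OF \<sigma>]] V_XX[OF t'] opt])
  with onA offA rho_id[OF t H_XX[OF t] H_L0[OF t]] rho_tower[OF step.hyps(2) stopped_XX[OF \<sigma>]]
    AE_space H'(2) R(2)
  have "AE \<omega> in P. \<rho> t (stopped_value H \<tau>) \<omega> = V t \<omega>"
    by eventually_elim (auto simp: V_rec[OF step.hyps(2)] A_def max_def)
  with \<tau> show ?case by blast
qed

lemma upper_Snell_is_ess_Sup: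
  assumes t: "t \<le> T"
  shows "is_ess_Sup P ((\<lambda>\<tau> \<omega>. ereal (\<rho> t (stopped_value H \<tau>) \<omega>)) ` stopping_times P F T t)
    (\<lambda>\<omega>. ereal (V t \<omega>))"
proof -
  obtain \<tau> where \<tau>: "\<tau> \<in> stopping_times P F T t"
    and opt: "AE \<omega> in P. \<rho> t (stopped_value H \<tau>) \<omega> = V t \<omega>"
    using value_attained[OF t] by blast
  show ?thesis
  proof (rule is_ess_Sup_attained)
    show "(\<lambda>\<omega>. ereal (V t \<omega>)) \<in> borel_measurable P"
      using L0_measurable[OF V_L0[OF t]] by simp
    show "AE \<omega> in P. ereal (\<rho> t (stopped_value H \<tau>) \<omega>) = ereal (V t \<omega>)"
      using opt by simp
  qed (use \<tau> rho_stopped_le_value[OF t] in auto)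
qed

lemma upper_Snell_eq:
  assumes t: "t \<le> T"
  shows "AE \<omega> in P. upper_Snell P F T \<rho> H t \<omega> = ereal (V t \<omega>)"
  unfolding upper_Snell_def by (rule AE_ess_Sup_eq[OF upper_Snell_is_ess_Sup[OF t]])

lemma upper_Snell_measurable:
  assumes t: "t \<le> T"
  shows "upper_Snell P F T \<rho> H t \<in> borel_measurable P"
proof -
  let ?\<Phi> = "(\<lambda>\<tau> \<omega>. ereal (\<rho> t (stopped_value H \<tau>) \<omega>)) ` stopping_times P F T t"
  have "is_ess_Sup P ?\<Phi> (ess_Sup P ?\<Phi>)"
    unfolding ess_Sup_def
    by (rule someI[of "is_ess_Sup P ?\<Phi>", OF upper_Snell_is_ess_Sup[OF t]])
  then show ?thesis by (simp add: upper_Snell_def is_ess_Sup_def)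
qed

section \<open>The dual representation\<close>

definition path_max :: "(nat \<Rightarrow> 'a \<Rightarrow> real) \<Rightarrow> nat \<Rightarrow> 'a \<Rightarrow> real" where
  "path_max M t = (\<lambda>\<omega>. MAX j\<in>{t..T}. H j \<omega> + M t \<omega> - M j \<omega>)"

lemma path_max_XX:
  assumes M: "M \<in> adapted_processes P F T \<XX>" and t: "t \<le> T"
  shows "path_max M t \<in> \<XX>"
  unfolding path_max_def using M t
  by (intro XX_Max XX_diff XX_add H_XX) (auto simp: adapted_processes_def)

lemma path_max_le_iff:
  "t \<le> T \<Longrightarrow> path_max M t \<omega> \<le> c \<longleftrightarrow> (\<forall>j\<in>{t..T}. H j \<omega> + M t \<omega> - M j \<omega> \<le> c)"
  unfolding path_max_def by (subst Max_le_iff) auto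

lemma path_max_ge: "j \<in> {t..T} \<Longrightarrow> H j \<omega> + M t \<omega> - M j \<omega> \<le> path_max M t \<omega>"
  unfolding path_max_def by (rule Max_ge) auto

text \<open>
  Since \<open>V\<^sub>t = max H\<^sub>t (\<rho>\<^sub>t V\<^sub>t\<^sub>+\<^sub>1)\<close>, both terms have to be bounded.  The first is dominated by
  the member \<open>j = t\<close> of the maximum.  For the second, the induction hypothesis and the tower property
  give \<open>\<rho>\<^sub>t V\<^sub>t\<^sub>+\<^sub>1 \<le> \<rho>\<^sub>t Z\<^sub>t\<^sub>+\<^sub>1(M)\<close>, and moving the base point of the maximum from \<open>t + 1\<close>
  back to \<open>t\<close> costs only a martingale increment.
\<close>

lemma value_le_rho_path_max:
  assumes M: "M \<in> rho_martingales P F T \<XX> \<rho>"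
  shows "t \<le> T \<Longrightarrow> AE \<omega> in P. V t \<omega> \<le> \<rho> t (path_max M t) \<omega>"
proof (induction t rule: inc_induct)
  case base
  have "path_max M T = H T" by (simp add: path_max_def)
  then show ?case using rho_id[OF order_refl H_XX H_L0] by (auto simp: V_T)
next
  case (step t)
  have t: "t \<le> T" and t': "Suc t \<le> T" using step.hyps by auto
  have Mad: "M \<in> adapted_processes P F T \<XX>"
    and mart: "AE \<omega> in P. M t \<omega> = \<rho> t (M (Suc t)) \<omega>"
    using M step.hyps by (auto simp: rho_martingales_def)
  have M_XX: "M t \<in> \<XX>" "M (Suc t) \<in> \<XX>" and M_L0: "M t \<in> L0 P (F t)"
    using Mad t t' by (auto simp: adapted_processes_def)
  note Z = path_max_XX[OF Mad t] and Z' = path_max_XX[OF Mad t']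
  \<comment> \<open>The increment has \<open>\<rho>\<^sub>t D = 0\<close>, so it drops out of the subadditive bound for
    \<open>\<rho>\<^sub>t (path_max M t + D)\<close>.\<close>
  define D where "D = (\<lambda>\<omega>. M (Suc t) \<omega> - M t \<omega>)"
  have D: "D \<in> \<XX>" unfolding D_def by (rule XX_diff[OF M_XX(2,1)])
  have rhoD: "AE \<omega> in P. \<rho> t D \<omega> = \<rho> t (M (Suc t)) \<omega> - M t \<omega>"
    unfolding D_def by (rule rho_diff[OF t M_XX(2,1) M_L0])
  have "H t \<omega> \<le> path_max M t \<omega>" for \<omega>
    using path_max_ge[of t t \<omega> M] t by simp
  then have "AE \<omega> in P. \<rho> t (H t) \<omega> \<le> \<rho> t (path_max M t) \<omega>"
    by (intro rho_mono[OF t H_XX[OF t] Z]) simp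
  moreover have "path_max M (Suc t) \<omega> \<le> path_max M t \<omega> + D \<omega>" for \<omega>
    unfolding path_max_le_iff[OF t']
  proof
    fix j assume "j \<in> {Suc t..T}"
    then show "H j \<omega> + M (Suc t) \<omega> - M j \<omega> \<le> path_max M t \<omega> + D \<omega>"
      using path_max_ge[of j t \<omega> M] by (simp add: D_def)
  qed
  then have "AE \<omega> in P. \<rho> t (path_max M (Suc t)) \<omega> \<le> \<rho> t (\<lambda>\<omega>. path_max M t \<omega> + D \<omega>) \<omega>"
    by (intro rho_mono[OF t Z' XX_add[OF Z D]]) simp
  moreover have "AE \<omega> in P. \<rho> t (V (Suc t)) \<omega> \<le> \<rho> t (\<rho> (Suc t) (path_max M (Suc t))) \<omega>"
    by (rule rho_mono[OF t V_XX[OF t'] rho_XX[OF t' Z'] step.IH])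
  ultimately show ?case
    using rho_id[OF t H_XX[OF t] H_L0[OF t]] rhoD mart rho_subadd[OF t Z D]
      rho_tower[OF step.hyps(2) Z']
    by eventually_elim (simp add: V_rec[OF step.hyps(2)])
qed

text \<open>
  In the lemmas that follow only the almost sure class of the process whose Doob martingale is taken
  matters, so it may be any measurable version of \<open>V\<close>, such as the upper Snell envelope.
\<close>

context
  fixes Y :: "nat \<Rightarrow> 'a \<Rightarrow> ereal"
  assumes Y_measurable: "\<And>t. t \<le> T \<Longrightarrow> Y t \<in> borel_measurable P"
    and Y_V: "\<And>t. t \<le> T \<Longrightarrow> AE \<omega> in P. Y t \<omega> = ereal (V t \<omega>)"
begin

abbreviation D where "D \<equiv> Doob_martingale \<rho> Y"

lemma real_Y_eq: "t \<le> T \<Longrightarrow> AE \<omega> in P. V t \<omega> = real_of_ereal (Y t \<omega>)"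
  using Y_V by fastforce

lemma real_Y_measurable: "t \<le> T \<Longrightarrow> (\<lambda>\<omega>. real_of_ereal (Y t \<omega>)) \<in> borel_measurable P"
  using Y_measurable by simp

lemma real_Y_XX: "t \<le> T \<Longrightarrow> (\<lambda>\<omega>. real_of_ereal (Y t \<omega>)) \<in> \<XX>"
  by (rule XX_AE_cong[OF V_XX real_Y_measurable real_Y_eq])

lemma real_Y_L0: "t \<le> T \<Longrightarrow> (\<lambda>\<omega>. real_of_ereal (Y t \<omega>)) \<in> L0 P (F t)"
  by (rule L0_AE_cong[OF V_L0 real_Y_measurable real_Y_eq])

lemma Doob_adapted: "D \<in> adapted_processes P F T \<XX>"
proof -
  have "t \<le> T \<longrightarrow> D t \<in> \<XX> \<inter> L0 P (F t)" for t
  proof (induction t)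
    case 0
    then show ?case by (simp add: XX_zero L0_const)
  next
    case (Suc t)
    show ?case
    proof (intro impI IntI)
      assume t': "Suc t \<le> T"
      then have t: "t \<le> T" by simp
      note R = rho_XX[OF t real_Y_XX[OF t']]
        L0_F_mono[OF le_SucI[OF order_refl] rho_L0[OF t real_Y_XX[OF t']]]
      show "D (Suc t) \<in> \<XX>"
        using Suc t XX_add[OF _ XX_diff[OF real_Y_XX[OF t'] R(1)]] by simp
      show "D (Suc t) \<in> L0 P (F (Suc t))"
        using Suc t L0_add[OF L0_F_mono L0_diff[OF real_Y_L0[OF t'] R(2)], of t "D t"] by simp
    qed
  qed
  then show ?thesis by (simp add: adapted_processes_def)
qed

lemma Doob_martingale_0: "D \<in> rho_martingales_0 P F T \<XX> \<rho>"
proof -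
  have "AE \<omega> in P. D t \<omega> = \<rho> t (D (Suc t)) \<omega>" if "t < T" for t
  proof -
    have t: "t \<le> T" and t': "Suc t \<le> T" using that by auto
    define y where "y = (\<lambda>\<omega>. real_of_ereal (Y (Suc t) \<omega>))"
    have y: "y \<in> \<XX>" unfolding y_def by (rule real_Y_XX[OF t'])
    have D: "D t \<in> \<XX>" "D t \<in> L0 P (F t)"
      using Doob_adapted t by (auto simp: adapted_processes_def)
    have "AE \<omega> in P. \<rho> t (\<lambda>\<omega>. y \<omega> + (D t \<omega> - \<rho> t y \<omega>)) \<omega> = \<rho> t y \<omega> + (D t \<omega> - \<rho> t y \<omega>)"
      by (rule rho_add[OF t y XX_diff[OF D(1) rho_XX[OF t y]] L0_diff[OF D(2) rho_L0[OF t y]]])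
    moreover have "D (Suc t) = (\<lambda>\<omega>. y \<omega> + (D t \<omega> - \<rho> t y \<omega>))"
      by (simp add: y_def algebra_simps)
    ultimately show ?thesis by (simp del: Doob_martingale.simps add: eq_commute)
  qed
  then show ?thesis
    using Doob_adapted by (simp add: rho_martingales_0_def rho_martingales_def)
qed

text \<open>
  The increment of the Doob martingale at \<open>t\<close> is \<open>V\<^sub>t\<^sub>+\<^sub>1 - \<rho>\<^sub>t V\<^sub>t\<^sub>+\<^sub>1\<close>, so the right-hand side exceeds
  the left-hand side by \<open>V\<^sub>t - \<rho>\<^sub>t V\<^sub>t\<^sub>+\<^sub>1\<close>, which is nonnegative by the recursion.
\<close>

lemma value_minus_Doob_decreasing:
  assumes "t < T"
  shows "AE \<omega> in P. V (Suc t) \<omega> - D (Suc t) \<omega> \<le> V t \<omega> - D t \<omega>"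
proof -
  have t: "t \<le> T" and t': "Suc t \<le> T" using assms by auto
  from real_Y_eq[OF t'] rho_AE_cong[OF t V_XX[OF t'] real_Y_XX[OF t'] real_Y_eq[OF t']]
  show ?thesis by eventually_elim (simp add: V_rec[OF assms])
qed

lemma path_max_Doob_le_value:
  assumes t: "t \<le> T"
  shows "AE \<omega> in P. path_max D t \<omega> \<le> V t \<omega>"
proof -
  have "AE \<omega> in P. \<forall>s\<in>{t..<T}. V (Suc s) \<omega> - D (Suc s) \<omega> \<le> V s \<omega> - D s \<omega>"
    using value_minus_Doob_decreasing by (intro AE_finite_allI) auto
  then show ?thesis
  proof eventually_elim
    case (elim \<omega>)
    have decr: "V j \<omega> - D j \<omega> \<le> V t \<omega> - D t \<omega>" if "t \<le> j" "j \<le> T" for j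
      using that
    proof (induction j rule: dec_induct)
      case (step s)
      then have "V (Suc s) \<omega> - D (Suc s) \<omega> \<le> V s \<omega> - D s \<omega>" by (intro elim[rule_format]) simp
      with step show ?case by (simp del: Doob_martingale.simps)
    qed simp
    show ?case
      unfolding path_max_le_iff[OF t]
    proof
      fix j assume "j \<in> {t..T}"
      then show "H j \<omega> + D t \<omega> - D j \<omega> \<le> V t \<omega>"
        using decr[of j] H_le_V[of j \<omega>] by simp
    qed
  qed
qed

lemma rho_path_max_Doob:
  assumes t: "t \<le> T"
  shows "AE \<omega> in P. \<rho> t (path_max D t) \<omega> = V t \<omega>"
proof -
  have "AE \<omega> in P. \<rho> t (path_max D t) \<omega> \<le> \<rho> t (V t) \<omega>"
    by (rule rho_mono[OF t path_max_XX[OF Doob_adapted t] V_XX[OF t] path_max_Doob_le_value[OF t]])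
  moreover have "AE \<omega> in P. V t \<omega> \<le> \<rho> t (path_max D t) \<omega>"
    using Doob_martingale_0 by (intro value_le_rho_path_max[OF _ t]) (simp add: rho_martingales_0_def)
  ultimately show ?thesis
    using rho_id[OF t V_XX[OF t] V_L0[OF t]] by eventually_elim simp
qed

lemma ess_Inf_rho_path_max:
  assumes t: "t \<le> T"
  shows "AE \<omega> in P. ess_Inf P ((\<lambda>M \<omega>. ereal (\<rho> t (path_max M t) \<omega>))
    ` rho_martingales_0 P F T \<XX> \<rho>) \<omega> = ereal (V t \<omega>)"
proof (rule AE_ess_Inf_eq, rule is_ess_Inf_attained)
  show "(\<lambda>\<omega>. ereal (V t \<omega>)) \<in> borel_measurable P"
    using L0_measurable[OF V_L0[OF t]] by simp
  show "AE \<omega> in P. ereal (\<rho> t (path_max D t) \<omega>) = ereal (V t \<omega>)"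
    using rho_path_max_Doob[OF t] by simp
next
  fix f assume "f \<in> (\<lambda>M \<omega>. ereal (\<rho> t (path_max M t) \<omega>)) ` rho_martingales_0 P F T \<XX> \<rho>"
  then obtain M where "M \<in> rho_martingales P F T \<XX> \<rho>"
    and f: "f = (\<lambda>\<omega>. ereal (\<rho> t (path_max M t) \<omega>))"
    by (auto simp: rho_martingales_0_def)
  with value_le_rho_path_max[OF _ t] show "AE \<omega> in P. ereal (V t \<omega>) \<le> f \<omega>" by simp
qed (rule imageI[OF Doob_martingale_0])

text \<open>
  Additivity for \<open>F\<^sub>t\<close>-measurable summands turns \<open>\<rho>\<^sub>t Z\<^sub>t(M\<^sup>*) = V\<^sub>t\<close> into the statement that
  the nonpositive gap \<open>Z\<^sub>t(M\<^sup>*) - V\<^sub>t\<close> has image \<open>0\<close>, which is the situation that sensitivity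
  excludes for a nonzero gap.
\<close>

lemma path_max_Doob_sensitive:
  assumes t: "t \<le> T" and P2: "P2 P T \<XX> \<rho>"
  shows "AE \<omega> in P. path_max D t \<omega> = V t \<omega>"
proof -
  define N where "N = (\<lambda>\<omega>. path_max D t \<omega> - V t \<omega>)"
  note Z = path_max_XX[OF Doob_adapted t]
  have N: "N \<in> \<XX>" unfolding N_def by (rule XX_diff[OF Z V_XX[OF t]])
  have nonpos: "AE \<omega> in P. N \<omega> \<le> 0"
    using path_max_Doob_le_value[OF t] by eventually_elim (simp add: N_def)
  have "AE \<omega> in P. \<rho> t N \<omega> = \<rho> t (path_max D t) \<omega> - V t \<omega>"
    unfolding N_def by (rule rho_diff[OF t Z V_XX[OF t] V_L0[OF t]])
  with rho_path_max_Doob[OF t] have "AE \<omega> in P. 0 \<le> \<rho> t N \<omega>"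
    by eventually_elim simp
  then have "AE \<omega> in P. N \<omega> = 0"
    using P2 t N nonpos by (simp add: P2_def)
  then show ?thesis by eventually_elim (simp add: N_def)
qed

end

end

theorem corollary3p2:
  fixes P :: "'a measure" and F :: "nat \<Rightarrow> 'a measure" and T :: nat
    and \<XX> :: "('a \<Rightarrow> real) set"
    and \<rho> :: "nat \<Rightarrow> ('a \<Rightarrow> real) \<Rightarrow> 'a \<Rightarrow> real"
    and H Mstar :: "nat \<Rightarrow> 'a \<Rightarrow> real"
    and Ystar :: "nat \<Rightarrow> 'a \<Rightarrow> ereal"
    and t :: nat
  assumes setting: "conditional_maps P F T \<XX> \<rho>"
    and "C1 P T \<XX> \<rho>" "C2 P F T \<XX> \<rho>" "C3 P T \<XX> \<rho>" "C4 P F T \<XX> \<rho>" "P1 P T \<XX> \<rho>"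
    and H: "H \<in> adapted_processes P F T \<XX>"
    and H_stopped: "\<And>\<tau>. \<tau> \<in> stopping_times P F T 0 \<Longrightarrow> stopped_value H \<tau> \<in> \<XX>"
    and t: "t \<le> T"
    and Ystar: "Ystar = upper_Snell P F T \<rho> H"
    and Mstar: "Mstar = Doob_martingale \<rho> Ystar"
  shows "(AE \<omega> in P. Ystar t \<omega> =
            ess_Inf P ((\<lambda>M \<omega>'. ereal (\<rho> t (\<lambda>\<omega>''. MAX j\<in>{t..T}. H j \<omega>'' + M t \<omega>'' - M j \<omega>'') \<omega>'))
              ` rho_martingales_0 P F T \<XX> \<rho>) \<omega>)
       \<and> (AE \<omega> in P. Ystar t \<omega> =
            ereal (\<rho> t (\<lambda>\<omega>'. MAX j\<in>{t..T}. H j \<omega>' + Mstar t \<omega>' - Mstar j \<omega>') \<omega>))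
       \<and> (P2 P T \<XX> \<rho> \<longrightarrow>
            (AE \<omega> in P. Ystar t \<omega> = ereal (MAX j\<in>{t..T}. H j \<omega> + Mstar t \<omega> - Mstar j \<omega>)))"
proof -
  interpret optimal_stopping P F T \<XX> \<rho> H
    using assms
    by (auto intro!: optimal_stopping.intro subadditive_conditional_maps.intro
        simp: subadditive_conditional_maps_axioms_def optimal_stopping_axioms_def)
  have Y: "Ystar s \<in> borel_measurable P" "AE \<omega> in P. Ystar s \<omega> = ereal (V s \<omega>)" if "s \<le> T" for s
    using upper_Snell_measurable[OF that] upper_Snell_eq[OF that] by (simp_all add: Ystar)
  have "AE \<omega> in P. ess_Inf P ((\<lambda>M \<omega>. ereal (\<rho> t (path_max M t) \<omega>))
      ` rho_martingales_0 P F T \<XX> \<rho>) \<omega> = ereal (V t \<omega>)"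
    by (rule ess_Inf_rho_path_max[of Ystar]) (use Y t in auto)
  with Y(2)[OF t] have "AE \<omega> in P. Ystar t \<omega> = ess_Inf P ((\<lambda>M \<omega>. ereal (\<rho> t (path_max M t) \<omega>))
      ` rho_martingales_0 P F T \<XX> \<rho>) \<omega>"
    by eventually_elim simp
  moreover have "AE \<omega> in P. \<rho> t (path_max Mstar t) \<omega> = V t \<omega>"
    unfolding Mstar by (rule rho_path_max_Doob) (use Y t in auto)
  with Y(2)[OF t] have "AE \<omega> in P. Ystar t \<omega> = ereal (\<rho> t (path_max Mstar t) \<omega>)"
    by eventually_elim simp
  moreover have "AE \<omega> in P. Ystar t \<omega> = ereal (path_max Mstar t \<omega>)" if P2: "P2 P T \<XX> \<rho>"
  proof -
    have "AE \<omega> in P. path_max Mstar t \<omega> = V t \<omega>"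
      unfolding Mstar by (rule path_max_Doob_sensitive) (use Y t P2 in auto)
    with Y(2)[OF t] show ?thesis by eventually_elim simp
  qed
  ultimately show ?thesis unfolding path_max_def by blast
qed

end
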